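(* Let $\mathcal{P}$ be a 2.5 player parity game and let $f$ be a Player $0$ strategy such that the winning region $W_0'$ of Player $0$ in the neutral subgame $\mathcal{P}'=\mathcal{P}\cap\mathrm{neutral}(\mathcal{P},f)$ is strictly larger than her winning region $W_0$ in $\mathcal{P}_{f}$. Then $\mathcal{I}'_{f}\neq\emptyset$ and, for all $f'\in\mathcal{I}'_{f}$, $\mathrm{val}^{\mathcal{P}}_{f'}>\mathrm{val}^{\mathcal{P}}_{f}$.
   Context: A 2.5 player parity game is a tuple $\mathcal{P}=(V_0,V_1,V_r,E,\mathrm{prob},\mathrm{pri})$, where $V_0,V_1,V_r$ are finite disjoint sets of vertices (owned by Player $0$, Player $1$, and Player random), $V=V_0\cup V_1\cup V_r$, $E\subseteq V\times V$ is such that every $v\in V$ has at least one successor, $E_\sigma=E\cap(V_\sigma\times V)$ for $\sigma\in\{0,1,r\}$, $\mathrm{prob}$ maps each $v\in V_r$ to a rational-valued probability distribution on $V$ with $\mathrm{prob}(v)(v')>0$ iff $(v,v')\in E$, and $\mathrm{pri}:V\to\mathbb{N}$ is the priority function. A play is an infinite path; Player $0$ wins it iff the minimal priority occurring infinitely often on it is even. A strategy of Player $\sigma\in\{0,1\}$ is always pure and memoryless: a map $f_\sigma:V_\sigma\to V$ with $(v,f_\sigma(v))\in E$ for all $v \in V_\sigma$; $\mathrm{Strats}_\sigma$ is the set of these. Fixing $f_0,f_1$ yields a Markov chain, and $\mathrm{val}^{\mathcal{P}}_{f_0,f_1}(v)$ is the probability that a play from $v$ is won by Player $0$; $\mathrm{val}^{\mathcal{P}}_{f_0}(v)=\inf_{f_1\in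 \mathrm{Strats}_1}\mathrm{val}^{\mathcal{P}}_{f_0,f_1}(v)$. A Player $0$ strategy $f$ is $v$-winning on $\mathcal{P}$ if $\mathrm{val}^{\mathcal{P}}_f(v)=1$. The winning region of Player $0$ on a game is the set of vertices $v$ for which she has a $v$-winning strategy on it. $\mathrm{val}^{\mathcal{P}}_{f'}>\mathrm{val}^{\mathcal{P}}_{f}$ means $\mathrm{val}^{\mathcal{P}}_{f'}(v)\geq\mathrm{val}^{\mathcal{P}}_{f}(v)$ for all $v\in V$ and $\mathrm{val}^{\mathcal{P}}_{f'}\neq\mathrm{val}^{\mathcal{P}}_{f}$. $\mathcal{P}_f$ is the game in which Player $0$'s choices are fixed to $f$; so her winning region in $\mathcal{P}_f$ is $W_0=\{v\in V\mid\mathrm{val}^{\mathcal{P}}_f(v)=1\}$. Neutral edges: $\mathrm{neutral}(\mathcal{P},f)=E_r\cup\{(v,v')\in E_0\cup E_1\mid \mathrm{val}^{\mathcal{P}}_f(v')=\mathrm{val}^{\mathcal{P}}_f(v)\}$; the neutral subgame $\mathcal{P}'=\mathcal{P}\cap\mathrm{neutral}(\mathcal{P},f)$ is $\mathcal{P}$ with edge set restricted to the neutral edges. Additional improvements $\mathcal{I}'_f$: let $W_0'$ be the winning region of Player $0$ on $\mathcal{P}'$. If $W_0=W_0'$, then $\mathcal{I}'_f=\emptyset$. Otherwise let $\mathcal{W}$ be the set of Player $0$ strategies on $\mathcal{P}'$ that are $v$-winning on $\mathcal{P}'$ for all $v\in W_0'$; then $\mathcal{I}'_f$ is the set of $f'\in\mathrm{Strats}_0$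 such that (i) there is $f_w\in\mathcal{W}$ with $f'(v)=f_w(v)$ for all $v\in V_0\cap W_0'$, (ii) $f'(v)=f(v)$ for all $v\in V_0\setminus W_0'$, and (iii) $f'(v)=f(v)$ for all $v\in V_0\cap W_0$. *)

theory Defs
  imports "HOL-Probability.Probability"
begin

section \<open>Markov chains\<close>

text \<open>
  The law on infinite paths of the Markov chain with transition kernel \<open>K\<close> started in \<open>v\<close>, as the
  Ionescu-Tulcea limit: position 0 is \<open>v\<close>, and position \<open>Suc n\<close> is drawn from \<open>K\<close> at position \<open>n\<close>.
\<close>

definition chain_kernel :: "('v \<Rightarrow> 'v pmf) \<Rightarrow> 'v \<Rightarrow> nat \<Rightarrow> (nat \<Rightarrow> 'v) \<Rightarrow> 'v measure" where
  "chain_kernel K v i \<omega> = measure_pmf (case i of 0 \<Rightarrow> return_pmf v | Suc n \<Rightarrow> K (\<omega> n))"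

definition markov_chain :: "('v \<Rightarrow> 'v pmf) \<Rightarrow> 'v \<Rightarrow> (nat \<Rightarrow> 'v) measure" where
  "markov_chain K v =
     projective_family.lim UNIV
       (Ionescu_Tulcea.CI (chain_kernel K v) (\<lambda>_. count_space UNIV)) (\<lambda>_. count_space UNIV)"

lemma Ionescu_Tulcea_chain_kernel:
  "Ionescu_Tulcea (chain_kernel K v) (\<lambda>_. count_space UNIV)"
proof (rule Ionescu_Tulcea.intro)
  fix i
  show "chain_kernel K v i \<in> measurable (PiM {0..<i} (\<lambda>_. count_space UNIV))
          (subprob_algebra (count_space UNIV))"
  proof (cases i)
    case 0
    have "chain_kernel K v i = (\<lambda>_. measure_pmf (return_pmf v))"
      by (auto simp: chain_kernel_def 0)
    then show ?thesis by (simp add: measure_pmf_in_subprob_algebra)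
  next
    case (Suc n)
    have eq: "chain_kernel K v i = (\<lambda>x. measure_pmf (K x)) \<circ> (\<lambda>\<omega>. \<omega> n)"
      by (auto simp: chain_kernel_def Suc)
    have "(\<lambda>\<omega>. \<omega> n) \<in> measurable (PiM {0..<i} (\<lambda>_. count_space UNIV)) (count_space UNIV)"
      by (rule measurable_component_singleton) (simp add: Suc)
    then show ?thesis unfolding eq
      by (rule measurable_comp) (simp add: measure_pmf_in_subprob_algebra)
  qed
qed (unfold chain_kernel_def, rule measure_pmf.prob_space_axioms)

lemma prob_space_markov_chain: "prob_space (markov_chain K v)"
proof -
  interpret Ionescu_Tulcea "chain_kernel K v" "\<lambda>_. count_space UNIV"
    by (rule Ionescu_Tulcea_chain_kernel)
  have e: "PF.emb UNIV {} {\<lambda>_. undefined} = UNIV"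
    by (auto simp: prod_emb_def space_PiM)
  have c: "CI {} {\<lambda>_. undefined} = 1"
    using prob_space.emeasure_space_1[OF PF.prob_space_P[of "{}"]] by (simp add: CI_def space_PiM)
  have "emeasure PF.lim UNIV = 1"
    using lim[of "{}" "{\<lambda>_. undefined}"] by (simp add: e c PiM_empty)
  moreover have "space PF.lim = UNIV"
    using sets_eq_imp_space_eq[OF PF.sets_lim] by (simp add: space_PiM)
  ultimately show ?thesis
    unfolding markov_chain_def by (intro prob_spaceI) simp
qed

lemma sets_markov_chain [measurable_cong]:
  "sets (markov_chain K v) = sets (PiM UNIV (\<lambda>_. count_space UNIV))"
proof -
  interpret Ionescu_Tulcea "chain_kernel K v" "\<lambda>_. count_space UNIV"
    by (rule Ionescu_Tulcea_chain_kernel)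
  show ?thesis unfolding markov_chain_def by (rule PF.sets_lim)
qed

lemma space_markov_chain [simp]: "space (markov_chain K v) = UNIV"
  using sets_eq_imp_space_eq[OF sets_markov_chain] by (simp add: space_PiM)

lemma emeasure_markov_chain_cylinder:
  "emeasure (markov_chain K v) {\<omega>. \<forall>i\<le>n. \<omega> i = x i} =
     (if x 0 = v then ennreal (\<Prod>i<n. pmf (K (x i)) (x (Suc i))) else 0)"
proof -
  interpret Ionescu_Tulcea "chain_kernel K v" "\<lambda>_. count_space UNIV"
    by (rule Ionescu_Tulcea_chain_kernel)
  let ?A = "\<lambda>m. PiE {0..<m} (\<lambda>i. {x i})"
  let ?S = "\<lambda>m. PiM {0..<m} (\<lambda>_. count_space UNIV)"
  have A [measurable]: "?A m \<in> sets (?S m)" for m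
    by (intro sets_PiM_I_finite) auto
  have upd: "(\<lambda>y. fun_upd \<omega> m y) -` ?A (Suc m) = (if \<omega> \<in> ?A m then {x m} else {})"
    if "\<omega> \<in> space (?S m)" for \<omega> m
    using that by (auto simp: space_PiM PiE_iff extensional_def atLeastLessThanSuc)
  have u [simp]: "(\<lambda>_. undefined) \<in> space (PiM {0..<0} (\<lambda>_. count_space UNIV))"
    by (auto simp: space_PiM PiE_iff extensional_def)
  have step: "emeasure (C 0 (Suc m) (\<lambda>_. undefined)) (?A (Suc m)) =
      emeasure (chain_kernel K v m x) {x m} * emeasure (C 0 m (\<lambda>_. undefined)) (?A m)" for m
  proof -
    have "emeasure (C 0 (Suc m) (\<lambda>_. undefined)) (?A (Suc m)) =
        (\<integral>\<^sup>+\<omega>. emeasure (eP m \<omega>) (?A (Suc m)) \<partial>C 0 m (\<lambda>_. undefined))"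
      using emeasure_bind[of "C 0 m (\<lambda>_. undefined)" "eP m" "?S (Suc m)" "?A (Suc m)"]
        measurable_eP[of m]
      by (simp add: space_C measurable_cong_sets[OF sets_C refl])
    also have "\<dots> = (\<integral>\<^sup>+\<omega>. emeasure (chain_kernel K v m x) {x m} * indicator (?A m) \<omega>
                      \<partial>C 0 m (\<lambda>_. undefined))"
    proof (rule nn_integral_cong)
      fix \<omega> assume "\<omega> \<in> space (C 0 m (\<lambda>_. undefined))"
      then have \<omega>: "\<omega> \<in> space (?S m)" by (simp add: space_C)
      show "emeasure (eP m \<omega>) (?A (Suc m)) =
          emeasure (chain_kernel K v m x) {x m} * indicator (?A m) \<omega>"
        using emeasure_eP[OF \<omega> A] upd[OF \<omega>]
        by (cases m) (auto simp: chain_kernel_def PiE_iff)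
    qed
    also have "\<dots> = emeasure (chain_kernel K v m x) {x m} * emeasure (C 0 m (\<lambda>_. undefined)) (?A m)"
      by (subst nn_integral_cmult_indicator) (simp_all add: sets_C)
    finally show ?thesis .
  qed
  have base: "emeasure (C 0 0 (\<lambda>_. undefined)) (?A 0) = 1"
    by (simp add: PiM_empty)
  have CA: "emeasure (C 0 (Suc m) (\<lambda>_. undefined)) (?A (Suc m)) =
     (if x 0 = v then ennreal (\<Prod>i<m. pmf (K (x i)) (x (Suc i))) else 0)" for m
  proof (induction m)
    case 0
    show ?case unfolding step base by (simp add: chain_kernel_def indicator_def)
  next
    case (Suc m)
    show ?case unfolding step[of "Suc m"] Suc.IH
      by (simp add: chain_kernel_def emeasure_pmf_single prod_nonneg ennreal_mult' mult.commute
               del: prod_ennreal)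
  qed
  have emb: "PF.emb UNIV {0..<Suc n} (?A (Suc n)) = {\<omega>. \<forall>i\<le>n. \<omega> i = x i}"
    by (auto simp: prod_emb_def space_PiM PiE_iff less_Suc_eq_le)
  have "emeasure (markov_chain K v) {\<omega>. \<forall>i\<le>n. \<omega> i = x i} = CI {0..<Suc n} (?A (Suc n))"
    using lim[OF _ A[of "Suc n"]] unfolding markov_chain_def emb by simp
  also have "\<dots> = C 0 (Suc n) (\<lambda>_. undefined) (PF.emb {0..<Suc n} {0..<Suc n} (?A (Suc n)))"
    by (rule emeasure_CI[OF _ A]) simp
  also have "PF.emb {0..<Suc n} {0..<Suc n} (?A (Suc n)) = ?A (Suc n)"
    by (rule prod_emb_id) (auto simp: PiE_iff extensional_def)
  finally show ?thesis unfolding CA .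
qed


section \<open>2.5 player parity games\<close>

text \<open>The fields \<open>V0\<close>, \<open>V1\<close>, \<open>Vr\<close> are the vertices of Player 0, Player 1 and Player random;
  \<open>succ_prob\<close> is relevant only on \<open>Vr\<close>.\<close>

record 'v game =
  V0 :: "'v set"
  V1 :: "'v set"
  Vr :: "'v set"
  edges :: "('v \<times> 'v) set"
  succ_prob :: "'v \<Rightarrow> 'v pmf"
  priority :: "'v \<Rightarrow> nat"

definition verts :: "'v game \<Rightarrow> 'v set" where
  "verts P = V0 P \<union> V1 P \<union> Vr P"

definition parity_game :: "'v game \<Rightarrow> bool" where
  "parity_game P \<longleftrightarrow>
     finite (V0 P) \<and> finite (V1 P) \<and> finite (Vr P) \<and>
     V0 P \<inter> V1 P = {} \<and> V0 P \<inter> Vr P = {} \<and> V1 P \<inter> Vr P = {} \<and>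
     edges P \<subseteq> verts P \<times> verts P \<and>
     (\<forall>v\<in>verts P. \<exists>w. (v, w) \<in> edges P) \<and>
     (\<forall>v\<in>Vr P. (\<forall>w. pmf (succ_prob P v) w \<in> \<rat>) \<and>
                 (\<forall>w. pmf (succ_prob P v) w > 0 \<longleftrightarrow> (v, w) \<in> edges P))"

text \<open>Strategies are extensional (\<open>undefined\<close> off the player's own vertices), so that they are
  exactly the maps from the player's vertices.\<close>

definition strats0 :: "'v game \<Rightarrow> ('v \<Rightarrow> 'v) set" where
  "strats0 P = (\<Pi>\<^sub>E v\<in>V0 P. {w. (v, w) \<in> edges P})"

definition strats1 :: "'v game \<Rightarrow> ('v \<Rightarrow> 'v) set" where
  "strats1 P = (\<Pi>\<^sub>E v\<in>V1 P. {w. (v, w) \<in> edges P})"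

definition step :: "'v game \<Rightarrow> ('v \<Rightarrow> 'v) \<Rightarrow> ('v \<Rightarrow> 'v) \<Rightarrow> 'v \<Rightarrow> 'v pmf" where
  "step P f0 f1 v =
     (if v \<in> V0 P then return_pmf (f0 v)
      else if v \<in> V1 P then return_pmf (f1 v)
      else succ_prob P v)"

definition won_by_0 :: "'v game \<Rightarrow> (nat \<Rightarrow> 'v) \<Rightarrow> bool" where
  "won_by_0 P \<omega> \<longleftrightarrow> even (LEAST p. \<exists>\<^sub>\<infinity>i. priority P (\<omega> i) = p)"

definition val2 :: "'v game \<Rightarrow> ('v \<Rightarrow> 'v) \<Rightarrow> ('v \<Rightarrow> 'v) \<Rightarrow> 'v \<Rightarrow> real" where
  "val2 P f0 f1 v = measure (markov_chain (step P f0 f1) v) {\<omega>. won_by_0 P \<omega>}"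

definition val :: "'v game \<Rightarrow> ('v \<Rightarrow> 'v) \<Rightarrow> 'v \<Rightarrow> real" where
  "val P f0 v = (INF f1\<in>strats1 P. val2 P f0 f1 v)"

definition val_greater :: "'v game \<Rightarrow> ('v \<Rightarrow> 'v) \<Rightarrow> ('v \<Rightarrow> 'v) \<Rightarrow> bool" where
  "val_greater P f' f \<longleftrightarrow>
     (\<forall>v\<in>verts P. val P f' v \<ge> val P f v) \<and> (\<exists>v\<in>verts P. val P f' v \<noteq> val P f v)"

definition winning_from :: "'v game \<Rightarrow> 'v \<Rightarrow> ('v \<Rightarrow> 'v) \<Rightarrow> bool" where
  "winning_from P v f \<longleftrightarrow> val P f v = 1"

definition winning_region :: "'v game \<Rightarrow> 'v set" where
  "winning_region P = {v \<in> verts P. \<exists>f\<in>strats0 P. winning_from P v f}"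

definition fix_strategy :: "'v game \<Rightarrow> ('v \<Rightarrow> 'v) \<Rightarrow> 'v game" where
  "fix_strategy P f = P\<lparr>edges := {(v, w) \<in> edges P. v \<in> V0 P \<longrightarrow> w = f v}\<rparr>"

definition neutral :: "'v game \<Rightarrow> ('v \<Rightarrow> 'v) \<Rightarrow> ('v \<times> 'v) set" where
  "neutral P f =
     {(v, w) \<in> edges P. v \<in> Vr P} \<union>
     {(v, w) \<in> edges P. v \<in> V0 P \<union> V1 P \<and> val P f w = val P f v}"

definition neutral_subgame :: "'v game \<Rightarrow> ('v \<Rightarrow> 'v) \<Rightarrow> 'v game" where
  "neutral_subgame P f = P\<lparr>edges := edges P \<inter> neutral P f\<rparr>"

definition additional_improvements :: "'v game \<Rightarrow> ('v \<Rightarrow> 'v) \<Rightarrow> ('v \<Rightarrow> 'v) set" where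
  "additional_improvements P f =
     (let P' = neutral_subgame P f;
          W0 = winning_region (fix_strategy P f);
          W0' = winning_region P';
          \<W> = {fw \<in> strats0 P'. \<forall>v\<in>W0'. winning_from P' v fw}
      in if W0 = W0' then {}
         else {f' \<in> strats0 P.
                 (\<exists>fw\<in>\<W>. \<forall>v\<in>V0 P \<inter> W0'. f' v = fw v) \<and>
                 (\<forall>v\<in>V0 P - W0'. f' v = f v) \<and>
                 (\<forall>v\<in>V0 P \<inter> W0. f' v = f v)})"

lemma sets_won_by_0 [measurable]: "{\<omega>. won_by_0 P \<omega>} \<in> sets (markov_chain K v)"
proof -
  have [measurable]: "(\<lambda>\<omega>. priority P (\<omega> i)) \<in> measurable (markov_chain K v) (count_space UNIV)" for i
  proof -
    have "(\<lambda>\<omega>. \<omega> i) \<in> measurable (markov_chain K v) (count_space UNIV)"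
      unfolding measurable_cong_sets[OF sets_markov_chain refl]
      by (rule measurable_component_singleton) simp
    then show ?thesis by (rule measurable_compose) simp
  qed
  have "{\<omega> \<in> space (markov_chain K v).
          even (LEAST p. \<exists>\<^sub>\<infinity>i. priority P (\<omega> i) = p)} \<in> sets (markov_chain K v)"
    unfolding INFM_nat by measurable
  then show ?thesis by (simp add: won_by_0_def)
qed

lemma winning_region_fix_strategy:
  assumes "parity_game P" and f: "f \<in> strats0 P"
  shows "winning_region (fix_strategy P f) = {v \<in> verts P. val P f v = 1}"
proof -
  let ?Q = "fix_strategy P f"
  have disj: "V0 P \<inter> V1 P = {}" using assms(1) by (simp add: parity_game_def)
  have s1: "strats1 ?Q = strats1 P"
    unfolding strats1_def using disj by (auto simp: fix_strategy_def intro!: PiE_cong)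
  have "strats0 ?Q = (\<Pi>\<^sub>E v\<in>V0 P. {f v})"
    unfolding strats0_def using f by (auto simp: fix_strategy_def strats0_def intro!: PiE_cong)
  also have "\<dots> = {f}"
    using f by (intro PiE_singleton) (auto simp: strats0_def PiE_iff)
  finally have s0: "strats0 ?Q = {f}" .
  have "step ?Q = step P" "won_by_0 ?Q = won_by_0 P"
    by (intro ext, simp add: step_def won_by_0_def fix_strategy_def)+
  then have "val ?Q f = val P f"
    by (intro ext) (simp only: val_def val2_def s1)
  then show ?thesis
    by (simp add: winning_region_def winning_from_def s0)
       (simp add: verts_def fix_strategy_def)
qed

end

theory Submission
  imports Defs
begin

text \<open>
  Write \<open>h = val P f\<close>. A finite Markov chain satisfies a maximum principle: a subharmonic function that
  is at most the (harmonic) winning probability \<open>u\<close> somewhere on every recurrent class is at most \<open>u\<close>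
  everywhere. An improvement \<open>f'\<close> uses only neutral edges, so \<open>h\<close> is subharmonic for \<open>f'\<close> against any
  opposing strategy \<open>g\<close>. On a recurrent class \<open>C\<close>, \<open>h\<close> is constant, so there \<open>g\<close> plays neutrally too.
  If \<open>C\<close> meets \<open>W0'\<close>, it lies in \<open>W0'\<close> and Player 0 wins almost surely on it; otherwise \<open>f'\<close> agrees
  with \<open>f\<close> on \<open>C\<close>, and \<open>u \<ge> h\<close> there by definition of \<open>h\<close>. Hence \<open>u \<ge> h\<close>. If equality held at a
  vertex of \<open>W0' - W0\<close>, it would propagate along the chain, so the play would never leave the neutral
  subgame and would be won almost surely, contradicting \<open>h < 1\<close>.

  That \<open>h\<close> is subharmonic for every \<open>g\<close> rests on a strategy of Player 1 that is optimal at all vertices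
  simultaneously; it too comes from the maximum principle.
\<close>

section \<open>One-step decomposition and locality of the path measure\<close>

abbreviation path_space :: "(nat \<Rightarrow> 'v) measure" where
  "path_space \<equiv> PiM UNIV (\<lambda>_. count_space UNIV)"

lemma sets_box: "{\<omega>. \<forall>i\<le>n. \<omega> i \<in> B i} \<in> sets (path_space :: (nat \<Rightarrow> 'v) measure)"
proof -
  have "{\<omega>. \<forall>i\<le>n. \<omega> i \<in> B i} = prod_emb UNIV (\<lambda>_. count_space UNIV) {..n} (PiE {..n} B)"
    by (auto simp: prod_emb_def space_PiM PiE_iff)
  then show ?thesis by (simp add: sets_PiM_I)
qed

lemma sets_cylinder: "{\<omega>. \<forall>i\<le>n. \<omega> i = x i} \<in> sets (path_space :: (nat \<Rightarrow> 'v) measure)"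
  using sets_box[of n "\<lambda>i. {x i}"] by simp

text \<open>Finite \<open>B i\<close> make the box a finite disjoint union of cylinders, indexed by
  the extensional choices for the positions up to \<open>n\<close>.\<close>

lemma emeasure_box:
  fixes M :: "(nat \<Rightarrow> 'v) measure"
  assumes M: "sets M = sets path_space" and fin: "\<And>i. finite (B i)"
  shows "emeasure M {\<omega>. \<forall>i\<le>n. \<omega> i \<in> B i} =
    (\<Sum>x\<in>PiE {..n} B. emeasure M {\<omega>. \<forall>i\<le>n. \<omega> i = x i})"
proof -
  have eq: "{\<omega>. \<forall>i\<le>n. \<omega> i \<in> B i} = (\<Union>x\<in>PiE {..n} B. {\<omega>. \<forall>i\<le>n. \<omega> i = x i})"
  proof (intro set_eqI iffI)
    fix \<omega> assume "\<omega> \<in> {\<omega>. \<forall>i\<le>n. \<omega> i \<in> B i}"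
    then show "\<omega> \<in> (\<Union>x\<in>PiE {..n} B. {\<omega>. \<forall>i\<le>n. \<omega> i = x i})"
      by (intro UN_I[of "restrict \<omega> {..n}"]) auto
  qed (auto simp: PiE_iff)
  show ?thesis unfolding eq
  proof (rule sum_emeasure[symmetric])
    show "(\<lambda>x. {\<omega>. \<forall>i\<le>n. \<omega> i = x i}) ` PiE {..n} B \<subseteq> sets M"
      using M sets_cylinder by auto
    show "disjoint_family_on (\<lambda>x. {\<omega>. \<forall>i\<le>n. \<omega> i = x i}) (PiE {..n} B)"
    proof (unfold disjoint_family_on_def, intro ballI impI)
      fix x y assume "x \<in> PiE {..n} B" "y \<in> PiE {..n} B" "x \<noteq> y"
      then obtain i where "i \<le> n" "x i \<noteq> y i" by (metis PiE_ext atMost_iff)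
      then show "{\<omega>. \<forall>i\<le>n. \<omega> i = x i} \<inter> {\<omega>. \<forall>i\<le>n. \<omega> i = y i} = {}" by auto
    qed
    show "finite (PiE {..n} B)" using fin by (intro finite_PiE) auto
  qed
qed

text \<open>The vertex type may be uncountable, so point cylinders need not generate the path space; they
  determine only measures concentrated on the paths in a finite set.\<close>

lemma path_measure_eqI:
  fixes M N :: "(nat \<Rightarrow> 'v) measure"
  assumes M: "sets M = sets path_space" "prob_space M" and N: "sets N = sets path_space" "prob_space N"
    and S: "finite S" "\<And>n. emeasure M {\<omega>. \<forall>i\<le>n. \<omega> i \<in> S} = 1"
    and cyl: "\<And>n x. (\<And>i. i \<le> n \<Longrightarrow> x i \<in> S) \<Longrightarrow>
      emeasure M {\<omega>. \<forall>i\<le>n. \<omega> i = x i} = emeasure N {\<omega>. \<forall>i\<le>n. \<omega> i = x i}"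
  shows "M = N"
proof (rule measure_eqI_PiM_infinite[OF M(1) N(1)])
  interpret M: prob_space M by (rule M)
  interpret N: prob_space N by (rule N)
  have space: "space M = UNIV" "space N = UNIV"
    using sets_eq_imp_space_eq[OF M(1)] sets_eq_imp_space_eq[OF N(1)] by (auto simp: space_PiM)
  have box: "emeasure M {\<omega>. \<forall>i\<le>n. \<omega> i \<in> B i \<inter> S} = emeasure N {\<omega>. \<forall>i\<le>n. \<omega> i \<in> B i \<inter> S}" for n B
    by (subst (1 2) emeasure_box) (use M N S cyl in \<open>auto intro!: sum.cong simp: PiE_iff\<close>)
  \<comment> \<open>Intersecting with \<open>S\<close> removes only a null set. Only
    \<open>M\<close> is assumed to live on \<open>S\<close>; for \<open>N\<close> this follows from
    \<open>box\<close> with \<open>UNIV\<close>.\<close>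
  have full: "emeasure L {\<omega>. \<forall>i\<le>n. \<omega> i \<in> B i \<inter> S} = emeasure L {\<omega>. \<forall>i\<le>n. \<omega> i \<in> B i}"
    if L: "L \<in> {M, N}" for L n B
  proof (rule emeasure_eq_AE)
    have L': "prob_space L" "sets L = sets path_space" using L M N by auto
    have "emeasure L {\<omega>. \<forall>i\<le>n. \<omega> i \<in> S} = 1"
      using L S(2)[of n] box[of n "\<lambda>_. UNIV"] by auto
    then have "AE \<omega> in L. \<omega> \<in> {\<omega>. \<forall>i\<le>n. \<omega> i \<in> S}"
      using L' sets_box[of n "\<lambda>_. S"]
      by (intro prob_space.AE_prob_1) (auto simp: measure_def)
    then show "AE \<omega> in L. \<omega> \<in> {\<omega>. \<forall>i\<le>n. \<omega> i \<in> B i \<inter> S} \<longleftrightarrow> \<omega> \<in> {\<omega>. \<forall>i\<le>n. \<omega> i \<in> B i}"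
      by eventually_elim auto
    show "{\<omega>. \<forall>i\<le>n. \<omega> i \<in> B i \<inter> S} \<in> sets L" "{\<omega>. \<forall>i\<le>n. \<omega> i \<in> B i} \<in> sets L"
      using L' sets_box[of n "\<lambda>i. B i \<inter> S"] sets_box[of n B] by auto
  qed
  show "finite_measure M" by (rule M.finite_measure_axioms)
  fix J :: "nat set" and A :: "nat \<Rightarrow> 'v set"
  assume J: "finite J"
  define n where "n = Max (insert 0 J)"
  have n: "i \<le> n" if "i \<in> J" for i using that J unfolding n_def by simp
  have "prod_emb UNIV (\<lambda>_. count_space UNIV) J (PiE J A) =
      {\<omega>. \<forall>i\<le>n. \<omega> i \<in> (if i \<in> J then A i else UNIV)}"
    using n by (auto simp: prod_emb_def space_PiM PiE_iff)
  then show "emeasure M (prod_emb UNIV (\<lambda>_. count_space UNIV) J (PiE J A)) =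
      emeasure N (prod_emb UNIV (\<lambda>_. count_space UNIV) J (PiE J A))"
    using box[of n] full by simp
qed

section \<open>Closed sets and the first step of the chain\<close>

definition closed_under :: "('v \<Rightarrow> 'v pmf) \<Rightarrow> 'v set \<Rightarrow> bool" where
  "closed_under K S \<longleftrightarrow> (\<forall>v\<in>S. set_pmf (K v) \<subseteq> S)"

lemma closed_underD: "closed_under K S \<Longrightarrow> v \<in> S \<Longrightarrow> w \<in> set_pmf (K v) \<Longrightarrow> w \<in> S"
  by (auto simp: closed_under_def)

text \<open>Splitting a cylinder by the state at time \<open>Suc n\<close> keeps all its mass,
  because the transition probabilities from a state of \<open>S\<close> into \<open>S\<close> sum to
  1.\<close>

lemma markov_chain_stays:
  assumes S: "finite S" "closed_under K S" "v \<in> S"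
  shows "emeasure (markov_chain K v) {\<omega>. \<forall>i\<le>n. \<omega> i \<in> S} = 1"
proof (induction n)
  case 0
  interpret prob_space "markov_chain K v" by (rule prob_space_markov_chain)
  have "1 = emeasure (markov_chain K v) {\<omega>. \<forall>i\<le>0. \<omega> i = v}"
    by (subst emeasure_markov_chain_cylinder) simp
  also have "\<dots> \<le> emeasure (markov_chain K v) {\<omega>. \<forall>i\<le>0. \<omega> i \<in> S}"
    using S sets_box[of 0 "\<lambda>_. S"] by (intro emeasure_mono) (auto simp: sets_markov_chain)
  finally show ?case using emeasure_le_1 by (intro antisym) auto
next
  case (Suc n)
  let ?M = "markov_chain K v"
  let ?c = "\<lambda>n x. emeasure ?M {\<omega>. \<forall>i\<le>n. \<omega> i = x i}"
  have one: "(\<Sum>s\<in>S. ennreal (pmf (K w) s)) = 1" if "w \<in> S" for w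
  proof -
    have "(\<Sum>s\<in>S. ennreal (pmf (K w) s)) = emeasure (K w) S"
      using S by (simp add: emeasure_measure_pmf_finite)
    also have "\<dots> = 1"
      using S that by (intro measure_pmf.emeasure_eq_1_AE) (auto simp: closed_under_def AE_measure_pmf_iff)
    finally show ?thesis .
  qed
  have ins: "{..Suc n} = insert (Suc n) {..n}" by auto
  have "emeasure ?M {\<omega>. \<forall>i\<le>Suc n. \<omega> i \<in> S} = (\<Sum>x\<in>PiE {..Suc n} (\<lambda>_. S). ?c (Suc n) x)"
    using S by (intro emeasure_box) (auto simp: sets_markov_chain)
  also have "\<dots> = (\<Sum>(s, x)\<in>S \<times> PiE {..n} (\<lambda>_. S). ?c (Suc n) (x(Suc n := s)))"
    unfolding ins PiE_insert_eq
    by (subst sum.reindex[OF inj_combinator]) (simp_all add: case_prod_unfold)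
  also have "\<dots> = (\<Sum>x\<in>PiE {..n} (\<lambda>_. S). \<Sum>s\<in>S. ?c (Suc n) (x(Suc n := s)))"
    by (subst sum.swap) (simp add: sum.cartesian_product)
  also have "\<dots> = (\<Sum>x\<in>PiE {..n} (\<lambda>_. S). \<Sum>s\<in>S. ?c n x * ennreal (pmf (K (x n)) s))"
    unfolding emeasure_markov_chain_cylinder
    by (intro sum.cong refl) (auto simp: ennreal_mult' prod_nonneg mult.commute simp del: prod_ennreal)
  also have "\<dots> = (\<Sum>x\<in>PiE {..n} (\<lambda>_. S). ?c n x)"
    by (intro sum.cong refl) (auto simp: sum_distrib_left[symmetric] one PiE_iff simp del: sum_ennreal)
  also have "\<dots> = emeasure ?M {\<omega>. \<forall>i\<le>n. \<omega> i \<in> S}"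
    using S by (intro emeasure_box[symmetric]) (auto simp: sets_markov_chain)
  finally show ?case using Suc by simp
qed

text \<open>A chain started in a closed set never uses the kernel outside it. This locality later
  replaces a strategy by another one that agrees with it on a closed set.\<close>

lemma markov_chain_cong:
  assumes S: "finite S" "closed_under K S" "v \<in> S" and K: "\<And>w. w \<in> S \<Longrightarrow> K w = K' w"
  shows "markov_chain K v = markov_chain K' v"
proof (rule path_measure_eqI[OF sets_markov_chain prob_space_markov_chain
      sets_markov_chain prob_space_markov_chain S(1) markov_chain_stays[OF S]])
  fix n and x :: "nat \<Rightarrow> 'a" assume "\<And>i. i \<le> n \<Longrightarrow> x i \<in> S"
  then show "emeasure (markov_chain K v) {\<omega>. \<forall>i\<le>n. \<omega> i = x i} =
      emeasure (markov_chain K' v) {\<omega>. \<forall>i\<le>n. \<omega> i = x i}"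
    unfolding emeasure_markov_chain_cylinder using K by (auto intro!: prod.cong)
qed

lemma measurable_case_nat_path:
  "case_nat v \<in> measurable (markov_chain K w) (path_space :: (nat \<Rightarrow> 'v) measure)"
proof (rule measurable_PiM_single')
  fix i :: nat
  show "(\<lambda>\<omega>. case_nat v \<omega> i) \<in> measurable (markov_chain K w) (count_space UNIV)"
    unfolding measurable_cong_sets[OF sets_markov_chain refl]
    by (cases i) (auto intro!: measurable_component_singleton)
qed auto

lemma all_le_Suc: "(\<forall>i\<le>Suc n. Q i) \<longleftrightarrow> Q 0 \<and> (\<forall>i\<le>n. Q (Suc i))"
  by (metis Suc_le_mono le0 not0_implies_Suc)

text \<open>Both sides give a cylinder the same product: averaging over \<open>w\<close> contributes
  the factor of the first transition, the chain started in \<open>w\<close> the others.\<close>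

lemma markov_chain_unfold:
  assumes S: "finite S" "closed_under K S" "v \<in> S"
  shows "markov_chain K v =
    measure_pmf (K v) \<bind> (\<lambda>w. distr (markov_chain K w) path_space (case_nat v))" (is "_ = ?N")
proof (rule path_measure_eqI[OF sets_markov_chain prob_space_markov_chain
      _ _ S(1) markov_chain_stays[OF S]])
  let ?D = "\<lambda>w. distr (markov_chain K w) path_space (case_nat v)"
  have D: "?D w \<in> space (prob_algebra path_space)" for w
    by (auto simp: space_prob_algebra
        intro!: prob_space.prob_space_distr[OF prob_space_markov_chain measurable_case_nat_path])
  have D': "?D \<in> measurable (measure_pmf (K v)) (prob_algebra path_space)"
    using D by auto
  show N: "sets ?N = sets path_space"
    by (rule sets_bind) auto
  show "prob_space ?N"
    by (rule prob_space_bind'[OF _ D'])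
       (auto simp: space_prob_algebra prob_space_measure_pmf)
  fix n and x :: "nat \<Rightarrow> 'a"
  have "emeasure ?N {\<omega>. \<forall>i\<le>n. \<omega> i = x i} = (\<integral>\<^sup>+w. emeasure (?D w) {\<omega>. \<forall>i\<le>n. \<omega> i = x i} \<partial>K v)"
    by (rule emeasure_bind_prob_algebra[OF _ D' sets_cylinder])
       (auto simp: space_prob_algebra prob_space_measure_pmf)
  also have "\<dots> = (\<integral>\<^sup>+w. (if x 0 = v then
      (case n of 0 \<Rightarrow> 1 | Suc m \<Rightarrow> ennreal (\<Prod>i<m. pmf (K (x (Suc i))) (x (Suc (Suc i)))) * indicator {x 1} w)
      else 0) \<partial>K v)"
  proof (rule nn_integral_cong)
    fix w
    interpret prob_space "markov_chain K w" by (rule prob_space_markov_chain)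
    have "case_nat v -` {\<omega>. \<forall>i\<le>n. \<omega> i = x i} =
       (if x 0 = v then (case n of 0 \<Rightarrow> UNIV | Suc m \<Rightarrow> {\<omega>. \<forall>i\<le>m. \<omega> i = x (Suc i)}) else {})"
      by (cases n) (auto simp: all_le_Suc)
    then show "emeasure (?D w) {\<omega>. \<forall>i\<le>n. \<omega> i = x i} = (if x 0 = v then
      (case n of 0 \<Rightarrow> 1 | Suc m \<Rightarrow> ennreal (\<Prod>i<m. pmf (K (x (Suc i))) (x (Suc (Suc i)))) * indicator {x 1} w)
      else 0)"
      using emeasure_space_1
      by (auto simp: emeasure_distr[OF measurable_case_nat_path sets_cylinder]
           emeasure_markov_chain_cylinder[of K w _ "\<lambda>i. x (Suc i)"] split: nat.splits)
  qed
  also have "\<dots> = emeasure (markov_chain K v) {\<omega>. \<forall>i\<le>n. \<omega> i = x i}"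
    unfolding emeasure_markov_chain_cylinder
    by (cases n) (auto simp: prod.lessThan_Suc_shift nn_integral_cmult_indicator measure_pmf.emeasure_space_1
         emeasure_pmf_single ennreal_mult'' prod_nonneg mult.commute[of "ennreal (pmf _ _)"]
         simp del: prod_ennreal prod.lessThan_Suc)
  finally show "emeasure (markov_chain K v) {\<omega>. \<forall>i\<le>n. \<omega> i = x i} = emeasure ?N {\<omega>. \<forall>i\<le>n. \<omega> i = x i}" ..
qed

text \<open>It takes a kernel instead of two strategies, so that kernels can be exchanged on closed
  sets; \<open>P\<close> enters only through its priorities.\<close>

definition win_prob :: "'v game \<Rightarrow> ('v \<Rightarrow> 'v pmf) \<Rightarrow> 'v \<Rightarrow> real" where
  "win_prob P K v = measure (markov_chain K v) {\<omega>. won_by_0 P \<omega>}"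

text \<open>The parity condition is a tail property: a shift by one position leaves the priorities
  seen infinitely often unchanged.\<close>

lemma won_by_0_case_nat: "won_by_0 P (case_nat v \<omega>) \<longleftrightarrow> won_by_0 P \<omega>"
proof -
  have "(\<exists>\<^sub>\<infinity>i. priority P (case_nat v \<omega> i) = p) \<longleftrightarrow> (\<exists>\<^sub>\<infinity>i. priority P (\<omega> i) = p)" for p
    unfolding frequently_def cofinite_eq_sequentially
    by (subst eventually_sequentially_Suc[symmetric]) simp
  then show ?thesis by (simp add: won_by_0_def)
qed

text \<open>Condition on the first step by \<open>markov_chain_unfold\<close>; prepending
  \<open>v\<close> does not affect who wins.\<close>

lemma win_prob_harmonic:
  assumes "finite S" "closed_under K S" "v \<in> S"
  shows "win_prob P K v = measure_pmf.expectation (K v) (win_prob P K)"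
proof -
  let ?W = "{\<omega>. won_by_0 P \<omega>}"
  let ?D = "\<lambda>w. distr (markov_chain K w) path_space (case_nat v)"
  have W: "?W \<in> sets path_space"
    using sets_won_by_0[of P K v] by (simp add: sets_markov_chain)
  have D': "?D \<in> measurable (measure_pmf (K v)) (prob_algebra path_space)"
    by (auto simp: space_prob_algebra
        intro!: prob_space.prob_space_distr[OF prob_space_markov_chain measurable_case_nat_path])
  have e: "emeasure (?D w) ?W = ennreal (win_prob P K w)" for w
  proof -
    interpret prob_space "markov_chain K w" by (rule prob_space_markov_chain)
    show ?thesis
      by (subst emeasure_distr[OF measurable_case_nat_path W])
         (simp add: vimage_def won_by_0_case_nat win_prob_def emeasure_eq_measure)
  qed
  have "ennreal (win_prob P K v) = emeasure (markov_chain K v) ?W"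
    using prob_space_markov_chain[of K v]
    by (simp add: win_prob_def finite_measure.emeasure_eq_measure prob_space_def)
  also have "\<dots> = (\<integral>\<^sup>+w. emeasure (?D w) ?W \<partial>K v)"
    by (subst markov_chain_unfold[OF assms], rule emeasure_bind_prob_algebra[OF _ D' W])
       (auto simp: space_prob_algebra prob_space_measure_pmf)
  also have "\<dots> = (\<integral>\<^sup>+w. ennreal (win_prob P K w) \<partial>K v)" by (simp add: e)
  also have "\<dots> = ennreal (measure_pmf.expectation (K v) (win_prob P K))"
    using assms by (intro nn_integral_eq_integral integrable_measure_pmf_finite)
      (auto simp: closed_under_def win_prob_def intro: finite_subset)
  finally show ?thesis
    by (subst (asm) ennreal_inj) (auto simp: win_prob_def)
qed

section \<open>The maximum principle\<close>

abbreviation expect :: "('v \<Rightarrow> 'v pmf) \<Rightarrow> ('v \<Rightarrow> real) \<Rightarrow> 'v \<Rightarrow> real" where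
  "expect K u v \<equiv> measure_pmf.expectation (K v) u"

lemma expectation_cong:
  assumes "\<And>w. w \<in> set_pmf p \<Longrightarrow> a w = (b w :: real)"
  shows "measure_pmf.expectation p a = measure_pmf.expectation p b"
  using assms by (intro integral_cong_AE) (auto simp: AE_measure_pmf_iff)

lemma expectation_mono:
  assumes "finite (set_pmf p)" "\<And>w. w \<in> set_pmf p \<Longrightarrow> a w \<le> (b w :: real)"
  shows "measure_pmf.expectation p a \<le> measure_pmf.expectation p b"
  using assms by (intro integral_mono_AE integrable_measure_pmf_finite) (auto simp: AE_measure_pmf_iff)

text \<open>The nonnegative difference of \<open>b\<close> and \<open>a\<close> has expectation 0,
  so it vanishes on the support. This is the equality case behind the maximum principle.\<close>

lemma expectation_eq_imp_eq:
  assumes "finite (set_pmf p)" "\<And>w. w \<in> set_pmf p \<Longrightarrow> a w \<le> (b w :: real)"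
    and "measure_pmf.expectation p b \<le> measure_pmf.expectation p a" "w \<in> set_pmf p"
  shows "a w = b w"
proof -
  have "AE w in measure_pmf p. a w = b w"
  proof (rule integral_ineq_eq_0_then_AE)
    show "measure_pmf.expectation p a = measure_pmf.expectation p b"
      by (rule antisym[OF expectation_mono assms(3)]) (use assms in auto)
  qed (use assms in \<open>auto simp: AE_measure_pmf_iff intro: integrable_measure_pmf_finite\<close>)
  then show ?thesis using assms by (auto simp: AE_measure_pmf_iff)
qed

lemma expectation_diff:
  assumes "finite (set_pmf p)"
  shows "measure_pmf.expectation p (\<lambda>w. a w - b w) =
    measure_pmf.expectation p a - (measure_pmf.expectation p b :: real)"
  using assms by (intro Bochner_Integration.integral_diff integrable_measure_pmf_finite)

section \<open>Recurrent classes and sets of maximisers\<close>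

lemma closed_under_Int: "closed_under K A \<Longrightarrow> closed_under K B \<Longrightarrow> closed_under K (A \<inter> B)"
  by (auto simp: closed_under_def)

text \<open>Minimality among nonempty closed sets captures the usual recurrent classes of a finite
  chain without mentioning return probabilities or reachability.\<close>

definition recurrent_class :: "('v \<Rightarrow> 'v pmf) \<Rightarrow> 'v set \<Rightarrow> bool" where
  "recurrent_class K C \<longleftrightarrow> C \<noteq> {} \<and> closed_under K C \<and>
     (\<forall>D. D \<subseteq> C \<longrightarrow> D \<noteq> {} \<longrightarrow> closed_under K D \<longrightarrow> D = C)"

text \<open>The intersection \<open>C \<inter> A\<close> is nonempty and closed, so minimality
  forces it to be \<open>C\<close>.\<close>

lemma recurrent_class_subset:
  assumes "recurrent_class K C" "closed_under K A" "C \<inter> A \<noteq> {}"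
  shows "C \<subseteq> A"
proof -
  have "closed_under K (C \<inter> A)" using assms by (auto simp: recurrent_class_def intro: closed_under_Int)
  then have "C \<inter> A = C" using assms(1,3) by (auto simp only: recurrent_class_def Int_lower1)
  then show ?thesis by blast
qed

lemma ex_recurrent_class:
  assumes "finite S" "S \<noteq> {}" "closed_under K S"
  obtains C where "C \<subseteq> S" "recurrent_class K C"
proof -
  let ?F = "{C. C \<subseteq> S \<and> C \<noteq> {} \<and> closed_under K C}"
  have "finite ?F" using assms by (intro finite_subset[of ?F "Pow S"]) auto
  moreover have "?F \<noteq> {}" using assms by blast
  ultimately have "\<exists>C\<in>?F. \<forall>D\<in>?F. D \<subseteq> C \<longrightarrow> C = D"
    by (rule finite_has_minimal)
  then obtain C where C: "C \<in> ?F" and min: "\<And>D. D \<in> ?F \<Longrightarrow> D \<subseteq> C \<Longrightarrow> C = D"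
    by auto
  have "recurrent_class K C"
    unfolding recurrent_class_def
  proof (intro conjI allI impI)
    fix D assume "D \<subseteq> C" "D \<noteq> {}" "closed_under K D"
    then show "D = C" using C min[of D] by blast
  qed (use C in auto)
  then show ?thesis using C that[of C] by simp
qed

lemma closed_under_finite: "finite S \<Longrightarrow> closed_under K S \<Longrightarrow> v \<in> S \<Longrightarrow> finite (set_pmf (K v))"
  by (auto simp: closed_under_def intro: finite_subset)

text \<open>At a vertex with value \<open>m\<close> the successors have mean at least
  \<open>m\<close> and values at most \<open>m\<close>, so all of them have value
  \<open>m\<close>.\<close>

lemma closed_under_argmax:
  assumes S: "finite S" "closed_under K S"
    and d: "\<And>v. v \<in> S \<Longrightarrow> d v \<le> expect K d v" "\<And>v. v \<in> S \<Longrightarrow> d v \<le> m"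
  shows "closed_under K {v \<in> S. d v = m}"
proof -
  have "d w = m" if "v \<in> S" "d v = m" "w \<in> set_pmf (K v)" for v w
  proof (rule expectation_eq_imp_eq[of "K v"])
    show "finite (set_pmf (K v))" using closed_under_finite[OF S that(1)] .
    show "d w \<le> m" if "w \<in> set_pmf (K v)" for w
      using that d(2)[of w] S(2) \<open>v \<in> S\<close> by (auto simp: closed_under_def)
    show "expect K (\<lambda>_. m) v \<le> expect K d v" using d(1)[OF that(1)] that(2) by simp
  qed fact
  then show ?thesis using S by (auto simp: closed_under_def)
qed

lemma ex_closed_argmax:
  assumes S: "finite S" "closed_under K S" "S \<noteq> {}"
    and d: "\<And>v. v \<in> S \<Longrightarrow> d v \<le> expect K d v"
  obtains m where "{v \<in> S. d v = m} \<noteq> {}" "closed_under K {v \<in> S. d v = m}" "\<And>v. v \<in> S \<Longrightarrow> d v \<le> m"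
proof -
  have le: "d v \<le> Max (d ` S)" if "v \<in> S" for v
    by (rule Max_ge[OF finite_imageI[OF S(1)] imageI[OF that]])
  have "Max (d ` S) \<in> d ` S" by (rule Max_in) (use S in auto)
  then obtain x where "x \<in> S" "d x = Max (d ` S)" by (metis imageE)
  then have ne: "{v \<in> S. d v = Max (d ` S)} \<noteq> {}" by blast
  show ?thesis by (rule that[OF ne closed_under_argmax[OF S(1,2) d le] le])
qed

text \<open>The maximisers of \<open>d\<close> form a nonempty closed subset of \<open>C\<close>,
  which is all of \<open>C\<close> by minimality.\<close>

lemma subharmonic_recurrent_class:
  assumes C: "finite C" "recurrent_class K C"
    and d: "\<And>v. v \<in> C \<Longrightarrow> d v \<le> expect K d v" and vw: "v \<in> C" "w \<in> C"
  shows "d v = d w"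
proof -
  have C': "closed_under K C" "C \<noteq> {}" using C(2) by (simp_all add: recurrent_class_def)
  obtain m where ne: "{v \<in> C. d v = m} \<noteq> {}" and cl: "closed_under K {v \<in> C. d v = m}"
    using ex_closed_argmax[OF C(1) C' d] by blast
  have "C \<inter> {v \<in> C. d v = m} \<noteq> {}" using ne by blast
  from recurrent_class_subset[OF C(2) cl this] show ?thesis using vw by blast
qed

text \<open>The maximisers of \<open>d\<close> on \<open>S\<close> contain a recurrent class, and
  one vertex of it with \<open>d \<le> 0\<close> bounds the maximum itself.\<close>

lemma maximum_principle:
  assumes S: "finite S" "closed_under K S"
    and d: "\<And>v. v \<in> S \<Longrightarrow> d v \<le> expect K d v"
    and rec: "\<And>C. C \<subseteq> S \<Longrightarrow> recurrent_class K C \<Longrightarrow> \<exists>v\<in>C. d v \<le> 0"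
    and v: "v \<in> S"
  shows "d v \<le> (0::real)"
proof -
  have "S \<noteq> {}" using v by blast
  obtain m where m: "{v \<in> S. d v = m} \<noteq> {}" "closed_under K {v \<in> S. d v = m}"
      "\<And>v. v \<in> S \<Longrightarrow> d v \<le> m"
    using ex_closed_argmax[OF S \<open>S \<noteq> {}\<close> d] by blast
  have "finite {v \<in> S. d v = m}" using S(1) by simp
  then obtain C where C: "C \<subseteq> {v \<in> S. d v = m}" "recurrent_class K C"
    using ex_recurrent_class[OF _ m(1,2)] by blast
  then obtain x where x: "x \<in> C" "d x \<le> 0" using rec[of C] by blast
  then have "m \<le> 0" using C(1) by blast
  then show ?thesis using m(3)[OF v] by simp
qed

section \<open>Comparison of winning probabilities with sub- and superharmonic functions\<close>

lemma win_prob_cong: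
  assumes "finite S" "closed_under K S" "v \<in> S" "\<And>w. w \<in> S \<Longrightarrow> K w = K' w"
  shows "win_prob P K v = win_prob P K' v"
  unfolding win_prob_def by (subst markov_chain_cong[OF assms]) auto

lemma win_prob_le_1: "win_prob P K v \<le> 1"
  unfolding win_prob_def by (rule prob_space.prob_le_1[OF prob_space_markov_chain])

text \<open>Subtracting the harmonic winning probability keeps \<open>h\<close> subharmonic, so the
  maximum principle reduces the comparison to one vertex per recurrent class.\<close>

lemma subharmonic_le_win_prob:
  assumes S: "finite S" "closed_under K S"
    and h: "\<And>v. v \<in> S \<Longrightarrow> h v \<le> expect K h v"
    and rec: "\<And>C. C \<subseteq> S \<Longrightarrow> recurrent_class K C \<Longrightarrow> \<exists>v\<in>C. h v \<le> win_prob P K v"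
    and v: "v \<in> S"
  shows "h v \<le> win_prob P K v"
proof -
  have "h v - win_prob P K v \<le> 0"
  proof (rule maximum_principle[OF S _ _ v])
    fix v assume v: "v \<in> S"
    show "h v - win_prob P K v \<le> expect K (\<lambda>v. h v - win_prob P K v) v"
      using h[OF v] win_prob_harmonic[OF S v, of P]
      by (simp add: expectation_diff closed_under_finite[OF S v])
  next
    fix C assume "C \<subseteq> S" "recurrent_class K C"
    from rec[OF this] show "\<exists>v\<in>C. h v - win_prob P K v \<le> 0" by simp
  qed
  then show ?thesis by simp
qed

lemma win_prob_le_superharmonic:
  assumes S: "finite S" "closed_under K S"
    and h: "\<And>v. v \<in> S \<Longrightarrow> expect K h v \<le> h v"
    and rec: "\<And>C. C \<subseteq> S \<Longrightarrow> recurrent_class K C \<Longrightarrow> \<exists>v\<in>C. win_prob P K v \<le> h v"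
    and v: "v \<in> S"
  shows "win_prob P K v \<le> h v"
proof -
  have "win_prob P K v - h v \<le> 0"
  proof (rule maximum_principle[OF S _ _ v])
    fix v assume v: "v \<in> S"
    show "win_prob P K v - h v \<le> expect K (\<lambda>v. win_prob P K v - h v) v"
      using h[OF v] win_prob_harmonic[OF S v, of P]
      by (simp add: expectation_diff closed_under_finite[OF S v])
  next
    fix C assume "C \<subseteq> S" "recurrent_class K C"
    from rec[OF this] show "\<exists>v\<in>C. win_prob P K v - h v \<le> 0" by simp
  qed
  then show ?thesis by simp
qed

section \<open>Values and optimal strategies\<close>

lemma val2_eq_win_prob: "val2 P f g = win_prob P (step P f g)"
  by (simp add: fun_eq_iff val2_def win_prob_def)

lemma finite_verts: "parity_game P \<Longrightarrow> finite (verts P)"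
  by (simp add: parity_game_def verts_def)

lemma set_pmf_succ_prob:
  "parity_game P \<Longrightarrow> v \<in> Vr P \<Longrightarrow> set_pmf (succ_prob P v) = {w. (v, w) \<in> edges P}"
  by (auto simp: parity_game_def pmf_positive_iff)

lemma strats0_edge: "f \<in> strats0 P \<Longrightarrow> v \<in> V0 P \<Longrightarrow> (v, f v) \<in> edges P"
  by (auto simp: strats0_def PiE_iff)

lemma strats1_edge: "g \<in> strats1 P \<Longrightarrow> v \<in> V1 P \<Longrightarrow> (v, g v) \<in> edges P"
  by (auto simp: strats1_def PiE_iff)

lemma strats0_if:
  "f \<in> strats0 P \<Longrightarrow> f' \<in> strats0 P \<Longrightarrow> (\<lambda>v. if Q v then f v else f' v) \<in> strats0 P"
  by (auto simp: strats0_def PiE_iff extensional_def)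

lemma strats1_if:
  "g \<in> strats1 P \<Longrightarrow> g' \<in> strats1 P \<Longrightarrow> (\<lambda>v. if Q v then g v else g' v) \<in> strats1 P"
  by (auto simp: strats1_def PiE_iff extensional_def)

lemma edges_verts: "parity_game P \<Longrightarrow> (v, w) \<in> edges P \<Longrightarrow> v \<in> verts P \<and> w \<in> verts P"
  by (auto simp: parity_game_def)

lemma step_Vr: "parity_game P \<Longrightarrow> v \<in> Vr P \<Longrightarrow> step P f g v = succ_prob P v"
  by (auto simp: step_def parity_game_def)

lemma step_V1: "parity_game P \<Longrightarrow> v \<in> V1 P \<Longrightarrow> step P f g v = return_pmf (g v)"
  by (auto simp: step_def parity_game_def)

lemma step_edge:
  assumes "parity_game P" "f \<in> strats0 P" "g \<in> strats1 P" "v \<in> verts P" "w \<in> set_pmf (step P f g v)"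
  shows "(v, w) \<in> edges P"
proof -
  consider "v \<in> V0 P" | "v \<in> V1 P" | "v \<in> Vr P" using assms(4) by (auto simp: verts_def)
  then show ?thesis
  proof cases
    case 1
    then show ?thesis using assms(5) strats0_edge[OF assms(2)] by (simp add: step_def)
  next
    case 2
    then show ?thesis using assms(5) strats1_edge[OF assms(3)] by (simp add: step_V1[OF assms(1)])
  next
    case 3
    then show ?thesis using assms(5) set_pmf_succ_prob[OF assms(1)] by (simp add: step_Vr[OF assms(1)])
  qed
qed

lemma closed_under_step:
  assumes "parity_game P" "f \<in> strats0 P" "g \<in> strats1 P"
  shows "closed_under (step P f g) (verts P)"
  unfolding closed_under_def using step_edge[OF assms] edges_verts[OF assms(1)] by blast

lemma val2_harmonic:
  assumes "parity_game P" "f \<in> strats0 P" "g \<in> strats1 P" "v \<in> verts P"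
  shows "val2 P f g v = expect (step P f g) (val2 P f g) v"
  unfolding val2_eq_win_prob
  by (rule win_prob_harmonic[OF finite_verts[OF assms(1)] closed_under_step[OF assms(1-3)] assms(4)])

section \<open>Attainment of the value and strategies optimal at every vertex\<close>

lemma finite_strats1:
  assumes "parity_game P"
  shows "finite (strats1 P)"
  unfolding strats1_def
proof (rule finite_PiE)
  show "finite (V1 P)" using assms by (simp add: parity_game_def)
  fix v
  have "{w. (v, w) \<in> edges P} \<subseteq> verts P" using edges_verts[OF assms] by blast
  then show "finite {w. (v, w) \<in> edges P}" using finite_verts[OF assms] by (rule finite_subset)
qed

lemma strats1_nonempty:
  assumes "parity_game P"
  shows "strats1 P \<noteq> {}"
proof -
  have "{w. (v, w) \<in> edges P} \<noteq> {}" if "v \<in> V1 P" for v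
    using assms that by (auto simp: parity_game_def verts_def)
  then show ?thesis unfolding strats1_def by (simp add: PiE_eq_empty_iff)
qed

lemma val_le_val2: "g \<in> strats1 P \<Longrightarrow> val P f v \<le> val2 P f g v"
  unfolding val_def by (rule cINF_lower) (auto simp: val2_def intro!: bdd_belowI[of _ 0])

text \<open>There are only finitely many pure memoryless strategies, so the infimum is a minimum.
  The minimiser may depend on \<open>v\<close>; \<open>ex_optimal_strategy\<close> removes this
  dependence.\<close>

lemma val_attained:
  assumes "parity_game P"
  obtains g where "g \<in> strats1 P" "val P f v = val2 P f g v"
proof -
  let ?A = "(\<lambda>g. val2 P f g v) ` strats1 P"
  have "val P f v = Min ?A"
    unfolding val_def by (rule cInf_eq_Min) (use assms finite_strats1 strats1_nonempty in auto)
  also have "\<dots> \<in> ?A"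
    by (rule Min_in) (use assms finite_strats1 strats1_nonempty in auto)
  finally show ?thesis using that by auto
qed

lemma val_le_1: "parity_game P \<Longrightarrow> val P f v \<le> 1"
  by (metis val_attained val2_eq_win_prob win_prob_le_1)

lemma superharmonic_recurrent_class:
  assumes C: "finite C" "recurrent_class K C"
    and h: "\<And>v. v \<in> C \<Longrightarrow> expect K h v \<le> h v" and vw: "v \<in> C" "w \<in> C"
  shows "h v = h w"
  using subharmonic_recurrent_class[OF C, of "\<lambda>v. - h v" v w] h vw by simp

text \<open>The minimum \<open>m\<close> of the two values is superharmonic for the combined strategy. On a recurrent class
  it is constant, which makes the set where \<open>g1\<close> is played closed. So only one of the two
  strategies is played on the class, and its value there is \<open>m\<close>.\<close>

lemma val2_min_strategy:
  assumes P: "parity_game P" and f: "f \<in> strats0 P"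
    and g: "g1 \<in> strats1 P" "g2 \<in> strats1 P" and v: "v \<in> verts P"
  defines "g3 \<equiv> \<lambda>v. if val2 P f g1 v \<le> val2 P f g2 v then g1 v else g2 v"
  shows "val2 P f g3 v \<le> min (val2 P f g1 v) (val2 P f g2 v)"
proof -
  let ?u1 = "val2 P f g1" and ?u2 = "val2 P f g2"
  let ?m = "\<lambda>v. min (?u1 v) (?u2 v)"
  let ?K1 = "step P f g1" and ?K2 = "step P f g2" and ?K = "step P f g3"
  have g3: "g3 \<in> strats1 P" unfolding g3_def using g by (rule strats1_if)
  have K: "?K v = (if ?u1 v \<le> ?u2 v then ?K1 v else ?K2 v)" for v
    by (auto simp: step_def g3_def)
  note S = finite_verts[OF P] closed_under_step[OF P f g3]
  have sup: "expect ?K ?m v \<le> ?m v" if v: "v \<in> verts P" for v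
  proof (cases "?u1 v \<le> ?u2 v")
    case True
    have "expect ?K1 ?m v \<le> expect ?K1 ?u1 v"
      using closed_under_finite[OF S(1) closed_under_step[OF P f g(1)] v] by (rule expectation_mono) auto
    then show ?thesis using True val2_harmonic[OF P f g(1) v] by (simp add: K)
  next
    case False
    have "expect ?K2 ?m v \<le> expect ?K2 ?u2 v"
      using closed_under_finite[OF S(1) closed_under_step[OF P f g(2)] v] by (rule expectation_mono) auto
    then show ?thesis using False val2_harmonic[OF P f g(2) v] by (simp add: K)
  qed
  show ?thesis unfolding val2_eq_win_prob[of P f g3]
  proof (rule win_prob_le_superharmonic[OF S sup _ v])
    fix C assume C: "C \<subseteq> verts P" "recurrent_class ?K C"
    then have fC: "finite C" and cl: "closed_under ?K C" and "C \<noteq> {}"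
      using S by (auto simp: recurrent_class_def intro: finite_subset)
    then obtain x where x: "x \<in> C" by auto
    obtain c where const: "?m y = c" if "y \<in> C" for y
      using superharmonic_recurrent_class[OF fC C(2), of ?m _ x] sup C(1) x by blast
    let ?D = "{v \<in> C. ?u1 v \<le> ?u2 v}"
    have "y \<in> ?D" if v: "v \<in> ?D" and y: "y \<in> set_pmf (?K v)" for v y
    proof -
      have "v \<in> verts P" and K1: "?K v = ?K1 v" using v C by (auto simp: K)
      have suc: "set_pmf (?K v) \<subseteq> C" using v cl by (auto simp: closed_under_def)
      \<comment> \<open>This amounts to \<open>?u1 y \<le> ?u2 y\<close>. It holds because
        \<open>?m\<close> lies below \<open>?u1\<close> while both have mean \<open>c\<close> over
        the successors of \<open>v\<close>.\<close>
      have "?m y = ?u1 y"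
      proof (rule expectation_eq_imp_eq[where a = ?m and b = ?u1, OF _ _ _ y])
        show "finite (set_pmf (?K v))" using suc fC by (rule finite_subset)
        have "expect ?K ?u1 v = ?u1 v" using val2_harmonic[OF P f g(1) \<open>v \<in> verts P\<close>] K1 by simp
        also have "\<dots> = c" using v const[of v] by simp
        also have "\<dots> = expect ?K ?m v"
          using suc const by (subst expectation_cong[of _ ?m "\<lambda>_. c"]) auto
        finally show "expect ?K ?u1 v \<le> expect ?K ?m v" by simp
      qed simp
      then show ?thesis using suc y by auto
    qed
    then have D: "closed_under ?K ?D" unfolding closed_under_def by blast
    show "\<exists>v\<in>C. win_prob P ?K v \<le> ?m v"
    proof (cases "?D = {}")
      case True
      then have "win_prob P ?K x = win_prob P ?K2 x"
        by (intro win_prob_cong[OF fC cl x]) (auto simp: K)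
      also have "\<dots> = ?m x" using True x by (auto simp: val2_eq_win_prob)
      finally show ?thesis by (intro bexI[of _ x] eq_refl x)
    next
      case False
      then have CD: "C \<subseteq> ?D" using recurrent_class_subset[OF C(2) D] by auto
      then have "win_prob P ?K x = win_prob P ?K1 x"
        by (intro win_prob_cong[OF fC cl x]) (auto simp: K)
      also have "\<dots> = ?m x" using CD x by (auto simp: val2_eq_win_prob)
      finally show ?thesis by (intro bexI[of _ x] eq_refl x)
    qed
  qed
qed

text \<open>Minimise the sum of the values over all vertices. A strategy better at one vertex could
  be merged in by \<open>val2_min_strategy\<close>, lowering one summand and raising none.\<close>

lemma ex_optimal_strategy:
  assumes P: "parity_game P" and f: "f \<in> strats0 P"
  obtains g where "g \<in> strats1 P" "\<And>v. v \<in> verts P \<Longrightarrow> val2 P f g v = val P f v"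
proof -
  let ?s = "\<lambda>g. \<Sum>v\<in>verts P. val2 P f g v"
  obtain g where g: "g \<in> strats1 P" and min: "\<And>g'. g' \<in> strats1 P \<Longrightarrow> ?s g \<le> ?s g'"
  proof -
    have fin: "finite (?s ` strats1 P)" "?s ` strats1 P \<noteq> {}"
      using finite_strats1[OF P] strats1_nonempty[OF P] by auto
    obtain g where "g \<in> strats1 P" "?s g = Min (?s ` strats1 P)" using Min_in[OF fin] by auto
    then show ?thesis using that[of g] Min_le[OF fin(1)] by simp
  qed
  have opt: "val2 P f g v = val P f v" if v: "v \<in> verts P" for v
  proof -
    obtain g' where g': "g' \<in> strats1 P" "val P f v = val2 P f g' v" using val_attained[OF P] .
    let ?g3 = "\<lambda>v. if val2 P f g v \<le> val2 P f g' v then g v else g' v"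
    have "?g3 \<in> strats1 P" using g g'(1) by (rule strats1_if)
    have le: "val2 P f ?g3 w \<le> min (val2 P f g w) (val2 P f g' w)" if "w \<in> verts P" for w
      using val2_min_strategy[OF P f g g'(1) that] .
    have "?s g \<le> ?s ?g3" using min \<open>?g3 \<in> strats1 P\<close> .
    moreover have "?s ?g3 \<le> ?s g" using le by (intro sum_mono) auto
    ultimately have "val2 P f ?g3 v = val2 P f g v"
      using sum_mono_inv[of "val2 P f ?g3" "verts P" "val2 P f g" v] le v finite_verts[OF P] by auto
    then have "val2 P f g v \<le> val P f v" using le[OF v] g'(2) by simp
    then show ?thesis using val_le_val2[OF g, of f v] by simp
  qed
  show ?thesis by (rule that[OF g opt])
qed

text \<open>Against a strategy optimal at every vertex, \<open>val\<close> equals the harmonic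
  \<open>val2\<close>, and \<open>f v\<close> is the sole successor of \<open>v\<close>. Hence
  \<open>f\<close> uses only neutral edges.\<close>

lemma val_strategy_succ:
  assumes P: "parity_game P" and f: "f \<in> strats0 P" and v: "v \<in> V0 P"
  shows "val P f (f v) = val P f v"
proof -
  obtain g where g: "g \<in> strats1 P" "\<And>v. v \<in> verts P \<Longrightarrow> val2 P f g v = val P f v"
    using ex_optimal_strategy[OF P f] by blast
  have "v \<in> verts P" "f v \<in> verts P" using v strats0_edge[OF f v] edges_verts[OF P] by auto
  then show ?thesis using val2_harmonic[OF P f g(1), of v] g(2) v by (simp add: step_def)
qed

text \<open>If the move to \<open>w\<close> lowered the value, the optimal value would be superharmonic after switching
  to it and not constant on \<open>{v, w}\<close>, so \<open>v\<close> would be transient and the switch an improvement.\<close>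

lemma val_le_succ:
  assumes P: "parity_game P" and f: "f \<in> strats0 P" and v: "v \<in> V1 P" and e: "(v, w) \<in> edges P"
  shows "val P f v \<le> val P f w"
proof (rule ccontr)
  let ?u = "val P f"
  assume "\<not> ?u v \<le> ?u w"
  then have less: "?u w < ?u v" by simp
  obtain g where g: "g \<in> strats1 P" and opt: "\<And>v. v \<in> verts P \<Longrightarrow> val2 P f g v = ?u v"
    using ex_optimal_strategy[OF P f] by blast
  have vw: "v \<in> verts P" "w \<in> verts P" using edges_verts[OF P e] by auto
  let ?g = "g(v := w)"
  have g3: "?g \<in> strats1 P" using g e v by (auto simp: strats1_def PiE_iff extensional_def)
  let ?K = "step P f ?g"
  note S = finite_verts[OF P] closed_under_step[OF P f g3]
  have K: "?K x = step P f g x" if "x \<noteq> v" for x using that by (simp add: step_def)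
  have Kv: "?K v = return_pmf w" using step_V1[OF P v] by simp
  have sup: "expect ?K ?u x \<le> ?u x" if x: "x \<in> verts P" for x
  proof (cases "x = v")
    case False
    have "expect ?K ?u x = expect (step P f g) (val2 P f g) x"
      unfolding K[OF False]
      by (intro expectation_cong opt[symmetric] closed_underD[OF closed_under_step[OF P f g] x])
    then show ?thesis using val2_harmonic[OF P f g x] opt[OF x] by simp
  qed (use less in \<open>simp add: Kv\<close>)
  have "val2 P f ?g w \<le> ?u w"
    unfolding val2_eq_win_prob
  proof (rule win_prob_le_superharmonic[OF S sup _ vw(2)])
    fix C assume C: "C \<subseteq> verts P" "recurrent_class ?K C"
    then have fC: "finite C" and cl: "closed_under ?K C" and "C \<noteq> {}"
      using S by (auto simp: recurrent_class_def intro: finite_subset)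
    then obtain x where x: "x \<in> C" by auto
    have "v \<notin> C"
    proof
      assume "v \<in> C"
      moreover have "w \<in> C" using \<open>v \<in> C\<close> cl Kv by (auto simp: closed_under_def)
      ultimately have "?u v = ?u w"
        using superharmonic_recurrent_class[OF fC C(2), of ?u v w] sup C(1) by auto
      then show False using less by simp
    qed
    then have "win_prob P ?K x = win_prob P (step P f g) x"
      by (intro win_prob_cong[OF fC cl x] K) auto
    also have "\<dots> = ?u x" using opt[of x] x C by (auto simp: val2_eq_win_prob)
    finally show "\<exists>v\<in>C. win_prob P ?K v \<le> ?u v" by (intro bexI[of _ x] eq_refl x)
  qed
  \<comment> \<open>From \<open>v\<close> the play moves surely to \<open>w\<close>, so
    \<open>?g\<close> would achieve at most \<open>?u w < ?u v\<close> from \<open>v\<close>,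
    against the definition of \<open>val\<close>.\<close>
  moreover have "val2 P f ?g v = val2 P f ?g w" using val2_harmonic[OF P f g3 vw(1)] Kv by simp
  ultimately show False using less val_le_val2[OF g3, of f v] by simp
qed

text \<open>The value is preserved by the moves of \<open>f\<close>, cannot decrease under a move of
  Player 1, and is averaged exactly at random vertices, whose kernel does not depend on
  \<open>g\<close>.\<close>

lemma val_subharmonic:
  assumes P: "parity_game P" and f: "f \<in> strats0 P" and g: "g \<in> strats1 P" and v: "v \<in> verts P"
  shows "val P f v \<le> expect (step P f g) (val P f) v"
proof -
  consider "v \<in> V0 P" | "v \<in> V1 P" | "v \<in> Vr P" using v by (auto simp: verts_def)
  then show ?thesis
  proof cases
    case 1
    then show ?thesis using val_strategy_succ[OF P f] by (simp add: step_def)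
  next
    case 2
    then show ?thesis using val_le_succ[OF P f 2 strats1_edge[OF g 2]] by (simp add: step_V1[OF P 2])
  next
    case 3
    obtain go where go: "go \<in> strats1 P" and opt: "\<And>v. v \<in> verts P \<Longrightarrow> val2 P f go v = val P f v"
      using ex_optimal_strategy[OF P f] by blast
    have "val P f v = expect (step P f go) (val2 P f go) v"
      using val2_harmonic[OF P f go v] opt[OF v] by simp
    also have "\<dots> = expect (step P f go) (val P f) v"
      by (intro expectation_cong opt closed_underD[OF closed_under_step[OF P f go] v])
    finally show ?thesis using step_Vr[OF P 3] by simp
  qed
qed

text \<open>Vertices of value 1 are maximisers of the subharmonic value, so no move of Player 1 and
  no random step leaves them.\<close>

lemma closed_under_val_1:
  assumes P: "parity_game P" and f: "f \<in> strats0 P" and g: "g \<in> strats1 P"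
  shows "closed_under (step P f g) {v \<in> verts P. val P f v = 1}"
  by (rule closed_under_argmax[OF finite_verts[OF P] closed_under_step[OF P f g]
      val_subharmonic[OF P f g] val_le_1[OF P]])

text \<open>The set where \<open>f1\<close> wins is closed under the combined play. So a recurrent
  class in the union either lies in it, where \<open>f1\<close> is played, or misses it, where
  \<open>f2\<close> is played; both ways the win is almost sure.\<close>

lemma val_1_combine:
  assumes P: "parity_game P" and f: "f1 \<in> strats0 P" "f2 \<in> strats0 P"
  defines "f3 \<equiv> \<lambda>v. if val P f1 v = 1 then f1 v else f2 v"
  assumes v: "v \<in> verts P" "val P f1 v = 1 \<or> val P f2 v = 1"
  shows "val P f3 v = 1"
proof -
  obtain g where g: "g \<in> strats1 P" "val P f3 v = val2 P f3 g v" using val_attained[OF P] .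
  let ?A = "{v \<in> verts P. val P f1 v = 1}" and ?B = "{v \<in> verts P. val P f2 v = 1}"
  let ?K = "step P f3 g"
  have K: "?K v = (if val P f1 v = 1 then step P f1 g v else step P f2 g v)" for v
    by (auto simp: step_def f3_def)
  have A: "closed_under ?K ?A" using closed_under_val_1[OF P f(1) g(1)] by (auto simp: closed_under_def K)
  have AB: "closed_under ?K (?A \<union> ?B)"
    using A closed_under_val_1[OF P f(2) g(1)] by (force simp: closed_under_def K)
  have fin: "finite (?A \<union> ?B)" using finite_verts[OF P] by simp
  have "1 \<le> win_prob P ?K v"
  proof (rule subharmonic_le_win_prob[OF fin AB, where h = "\<lambda>_. 1"])
    fix C assume C: "C \<subseteq> ?A \<union> ?B" "recurrent_class ?K C"
    then have fC: "finite C" and cl: "closed_under ?K C" and "C \<noteq> {}"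
      using fin by (auto simp: recurrent_class_def intro: finite_subset)
    then obtain x where x: "x \<in> C" by auto
    show "\<exists>v\<in>C. 1 \<le> win_prob P ?K v"
    proof (cases "C \<inter> ?A = {}")
      case True
      then have "win_prob P ?K x = val2 P f2 g x"
        unfolding val2_eq_win_prob using C by (intro win_prob_cong[OF fC cl x]) (auto simp: K)
      moreover have "val P f2 x = 1" using True C x by auto
      ultimately show ?thesis using val_le_val2[OF g(1), of f2 x] by (intro bexI[OF _ x]) simp
    next
      case False
      then have CA: "C \<subseteq> ?A" using recurrent_class_subset[OF C(2) A] by simp
      then have "win_prob P ?K x = val2 P f1 g x"
        unfolding val2_eq_win_prob by (intro win_prob_cong[OF fC cl x]) (auto simp: K)
      moreover have "val P f1 x = 1" using CA x by auto
      ultimately show ?thesis using val_le_val2[OF g(1), of f1 x] by (intro bexI[OF _ x]) simp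
    qed
  qed (use v in auto)
  then show ?thesis using win_prob_le_1[of P ?K v] g(2) by (simp add: val2_eq_win_prob)
qed

text \<open>Winning strategies for single vertices are merged one by one, starting from
  \<open>f\<close>. Agreement with \<open>f\<close> where it already wins serves the last condition
  in \<open>additional_improvements\<close>.\<close>

lemma ex_uniform_winning_strategy:
  assumes P: "parity_game P" and f: "f \<in> strats0 P"
  obtains f' where "f' \<in> strats0 P" "\<And>v. v \<in> winning_region P \<Longrightarrow> val P f' v = 1"
    "\<And>v. v \<in> verts P \<Longrightarrow> val P f v = 1 \<Longrightarrow> f' v = f v"
proof -
  have "\<exists>f'\<in>strats0 P. (\<forall>v\<in>verts P. v \<in> X \<or> val P f v = 1 \<longrightarrow> val P f' v = 1) \<and>
      (\<forall>v\<in>verts P. val P f v = 1 \<longrightarrow> f' v = f v)"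
    if "finite X" "X \<subseteq> winning_region P" for X
    using that
  proof (induction X)
    case empty
    show ?case using f by auto
  next
    case (insert w X)
    then obtain f1 where f1: "f1 \<in> strats0 P"
      "\<And>v. v \<in> verts P \<Longrightarrow> v \<in> X \<or> val P f v = 1 \<Longrightarrow> val P f1 v = 1"
      "\<And>v. v \<in> verts P \<Longrightarrow> val P f v = 1 \<Longrightarrow> f1 v = f v" by auto
    obtain f2 where f2: "f2 \<in> strats0 P" "val P f2 w = 1"
      using insert.prems by (auto simp: winning_region_def winning_from_def)
    \<comment> \<open>\<open>f1\<close> takes precedence, so what has been secured already,
      including the choices of \<open>f\<close>, survives the merge.\<close>
    let ?f3 = "\<lambda>v. if val P f1 v = 1 then f1 v else f2 v"
    have "?f3 \<in> strats0 P" using f1(1) f2(1) by (rule strats0_if)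
    moreover have "val P ?f3 v = 1" if "v \<in> verts P" "v \<in> insert w X \<or> val P f v = 1" for v
      using val_1_combine[OF P f1(1) f2(1) that(1)] that f1(2)[of v] f2(2) by blast
    ultimately show ?case using f1 by (intro bexI[of _ ?f3]) auto
  qed
  from this[of "winning_region P"] that show ?thesis
    using finite_verts[OF P] by (force simp: winning_region_def)
qed

section \<open>The neutral subgame\<close>

lemma neutral_subgame_simps [simp]:
  "V0 (neutral_subgame P f) = V0 P" "V1 (neutral_subgame P f) = V1 P"
  "Vr (neutral_subgame P f) = Vr P" "verts (neutral_subgame P f) = verts P"
  "succ_prob (neutral_subgame P f) = succ_prob P" "priority (neutral_subgame P f) = priority P"
  by (simp_all add: neutral_subgame_def verts_def)

lemma step_neutral_subgame [simp]: "step (neutral_subgame P f) = step P"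
  by (simp add: fun_eq_iff step_def)

lemma val2_neutral_subgame [simp]: "val2 (neutral_subgame P f) = val2 P"
  by (simp add: fun_eq_iff val2_def won_by_0_def)

lemma edges_neutral_subgame:
  assumes "parity_game P"
  shows "(v, w) \<in> edges (neutral_subgame P f) \<longleftrightarrow>
    (v, w) \<in> edges P \<and> (v \<in> V0 P \<union> V1 P \<longrightarrow> val P f w = val P f v)"
  using assms by (auto simp: neutral_subgame_def neutral_def parity_game_def verts_def)

lemma strats0_neutral_subgame_subset: "strats0 (neutral_subgame P f) \<subseteq> strats0 P"
  unfolding strats0_def neutral_subgame_simps by (intro PiE_mono) (auto simp: neutral_subgame_def)

lemma strats1_neutral_subgame_subset: "strats1 (neutral_subgame P f) \<subseteq> strats1 P"
  unfolding strats1_def neutral_subgame_simps by (intro PiE_mono) (auto simp: neutral_subgame_def)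

lemma strategy_in_neutral_subgame:
  assumes P: "parity_game P" and f: "f \<in> strats0 P"
  shows "f \<in> strats0 (neutral_subgame P f)"
  unfolding strats0_def neutral_subgame_simps
proof (rule PiE_I)
  fix v assume "v \<in> V0 P"
  then show "f v \<in> {w. (v, w) \<in> edges (neutral_subgame P f)}"
    using strats0_edge[OF f] val_strategy_succ[OF P f] by (simp add: edges_neutral_subgame[OF P])
next
  fix v assume "v \<notin> V0 P"
  then show "f v = undefined" using f by (simp add: strats0_def PiE_iff extensional_def)
qed

text \<open>Every vertex keeps a successor: Player 0 has the move of \<open>f\<close>, Player 1 the
  move of a strategy optimal at every vertex, and the random edges all remain.\<close>

lemma parity_game_neutral_subgame:
  assumes P: "parity_game P" and f: "f \<in> strats0 P"
  shows "parity_game (neutral_subgame P f)"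
proof -
  have succ: "\<exists>w. (v, w) \<in> edges (neutral_subgame P f)" if v: "v \<in> verts P" for v
  proof -
    consider "v \<in> V0 P" | "v \<in> V1 P" | "v \<in> Vr P" using v by (auto simp: verts_def)
    then show ?thesis
    proof cases
      case 1
      then show ?thesis
        using strats0_edge[OF strategy_in_neutral_subgame[OF P f], of v] by auto
    next
      case 2
      obtain g where g: "g \<in> strats1 P" and opt: "\<And>v. v \<in> verts P \<Longrightarrow> val2 P f g v = val P f v"
        using ex_optimal_strategy[OF P f] by blast
      have e: "(v, g v) \<in> edges P" using strats1_edge[OF g 2] .
      have "val P f (g v) = val P f v"
        using val2_harmonic[OF P f g v] opt[of v] opt[of "g v"] edges_verts[OF P e] step_V1[OF P 2]
        by simp
      then show ?thesis using e by (auto simp: edges_neutral_subgame[OF P])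
    next
      case 3
      then have "v \<notin> V0 P \<union> V1 P" using P by (auto simp: parity_game_def)
      moreover have "\<exists>w. (v, w) \<in> edges P" using P v by (simp add: parity_game_def)
      then obtain w where "(v, w) \<in> edges P" ..
      ultimately show ?thesis using edges_neutral_subgame[OF P, of v w f] by blast
    qed
  qed
  show ?thesis
    unfolding parity_game_def neutral_subgame_simps
  proof (intro conjI)
    show "edges (neutral_subgame P f) \<subseteq> verts P \<times> verts P"
      using P by (auto simp: parity_game_def neutral_subgame_def)
    show "\<forall>v\<in>verts P. \<exists>w. (v, w) \<in> edges (neutral_subgame P f)" using succ by blast
    have "(v, w) \<in> edges (neutral_subgame P f) \<longleftrightarrow> (v, w) \<in> edges P" if "v \<in> Vr P" for v w
    proof -
      have "v \<notin> V0 P \<union> V1 P" using P that by (auto simp: parity_game_def)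
      then show ?thesis using edges_neutral_subgame[OF P] by blast
    qed
    then show "\<forall>v\<in>Vr P. (\<forall>w. pmf (succ_prob P v) w \<in> \<rat>) \<and>
        (\<forall>w. (0 < pmf (succ_prob P v) w) = ((v, w) \<in> edges (neutral_subgame P f)))"
      using P by (simp add: parity_game_def)
  qed (use P in \<open>simp_all add: parity_game_def\<close>)
qed

text \<open>Fewer strategies of Player 1 can only raise the infimum.\<close>

lemma val_le_val_neutral_subgame:
  assumes P: "parity_game P" and f: "f \<in> strats0 P"
  shows "val P f' v \<le> val (neutral_subgame P f) f' v"
proof -
  obtain g where g: "g \<in> strats1 (neutral_subgame P f)"
      "val (neutral_subgame P f) f' v = val2 (neutral_subgame P f) f' g v"
    using val_attained[OF parity_game_neutral_subgame[OF P f]] .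
  have "val P f' v \<le> val2 P f' g v"
    using g(1) strats1_neutral_subgame_subset by (intro val_le_val2) (rule subsetD)
  then show ?thesis using g(2) by simp
qed

section \<open>Existence of additional improvements and strict increase of the value\<close>

lemma additional_improvements_nonempty:
  assumes P: "parity_game P" and f: "f \<in> strats0 P"
    and less: "winning_region (fix_strategy P f) \<subset> winning_region (neutral_subgame P f)"
  shows "additional_improvements P f \<noteq> {}"
proof -
  let ?P' = "neutral_subgame P f"
  let ?W0 = "winning_region (fix_strategy P f)" and ?W0' = "winning_region ?P'"
  note P' = parity_game_neutral_subgame[OF P f]
  obtain fw where fw: "fw \<in> strats0 ?P'" "\<And>v. v \<in> ?W0' \<Longrightarrow> val ?P' fw v = 1"
    "\<And>v. v \<in> verts ?P' \<Longrightarrow> val ?P' f v = 1 \<Longrightarrow> fw v = f v"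
    using ex_uniform_winning_strategy[OF P' strategy_in_neutral_subgame[OF P f]] by blast
  let ?f' = "\<lambda>v. if v \<in> ?W0' then fw v else f v"
  have "?f' \<in> strats0 P" using fw(1) f strats0_neutral_subgame_subset by (intro strats0_if) auto
  \<comment> \<open>\<open>f\<close> still has value 1 on \<open>?W0\<close> in the neutral subgame,
    and \<open>fw\<close> was chosen to extend \<open>f\<close> wherever \<open>f\<close> wins
    there.\<close>
  moreover have fw_f: "fw v = f v" if "v \<in> ?W0" for v
  proof (rule fw(3))
    have v: "v \<in> verts P" "val P f v = 1" using that winning_region_fix_strategy[OF P f] by auto
    then show "v \<in> verts ?P'" by simp
    show "val ?P' f v = 1" using val_le_val_neutral_subgame[OF P f, of f v] val_le_1[OF P', of f v] v by simp
  qed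
  moreover have "\<forall>v\<in>V0 P \<inter> ?W0. ?f' v = f v" using fw_f by simp
  moreover have "\<forall>v\<in>V0 P \<inter> ?W0'. ?f' v = fw v" "\<forall>v\<in>V0 P - ?W0'. ?f' v = f v" by simp_all
  moreover have "?W0 \<noteq> ?W0'" using less by blast
  ultimately have "?f' \<in> additional_improvements P f"
    using fw(1,2) unfolding additional_improvements_def Let_def winning_from_def by auto
  then show ?thesis by blast
qed

lemma additional_improvements_val_greater:
  assumes P: "parity_game P" and f: "f \<in> strats0 P"
    and less: "winning_region (fix_strategy P f) \<subset> winning_region (neutral_subgame P f)"
    and f': "f' \<in> additional_improvements P f"
  shows "val_greater P f' f"
proof -
  let ?P' = "neutral_subgame P f" and ?h = "val P f"
  define W where "W = winning_region ?P'"
  note P' = parity_game_neutral_subgame[OF P f]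
  have ne: "winning_region (fix_strategy P f) \<noteq> W" using less by (simp add: W_def)
  obtain fw where f'0: "f' \<in> strats0 P" and fw: "fw \<in> strats0 ?P'"
    and fw_props: "\<forall>v\<in>W. val ?P' fw v = 1" "\<forall>v\<in>V0 P \<inter> W. f' v = fw v" "\<forall>v\<in>V0 P - W. f' v = f v"
    using f' unfolding additional_improvements_def Let_def winning_from_def W_def[symmetric] if_not_P[OF ne]
    by blast
  have win: "\<And>v. v \<in> W \<Longrightarrow> val ?P' fw v = 1"
    and f'W: "\<And>v. v \<in> V0 P \<Longrightarrow> v \<in> W \<Longrightarrow> f' v = fw v"
    and f'f: "\<And>v. v \<in> V0 P \<Longrightarrow> v \<notin> W \<Longrightarrow> f' v = f v"
    using fw_props by blast+
  \<comment> \<open>So \<open>W\<close> is the value-1 set of the single strategy \<open>fw\<close>,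
    which makes it closed under play in the neutral subgame.\<close>
  have W: "W = {v \<in> verts P. val ?P' fw v = 1}"
    using win fw by (auto simp: W_def winning_region_def winning_from_def)
  have neutral: "?h (f' v) = ?h v" if v: "v \<in> V0 P" for v
    using strats0_edge[OF fw, of v] v f'W[OF v] f'f[OF v] val_strategy_succ[OF P f v]
    by (cases "v \<in> W") (auto simp: edges_neutral_subgame[OF P])
  obtain gn where gn: "gn \<in> strats1 ?P'" using strats1_nonempty[OF P'] by auto
  \<comment> \<open>Non-neutral moves of \<open>g\<close> are replaced by those of an arbitrary
    neutral strategy \<open>gn\<close>, so that \<open>fw\<close> can be confronted with
    \<open>gw g\<close> inside the neutral subgame.\<close>
  define gw where "gw g = (\<lambda>v. if v \<in> V1 P \<and> ?h (g v) = ?h v then g v else gn v)" for g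
  have gw: "gw g \<in> strats1 ?P'" if "g \<in> strats1 P" for g
    unfolding strats1_def
  proof (rule PiE_I)
    fix v assume "v \<in> V1 ?P'"
    then show "gw g v \<in> {w. (v, w) \<in> edges ?P'}"
      using strats1_edge[OF that, of v] strats1_edge[OF gn, of v]
      by (simp add: gw_def edges_neutral_subgame[OF P])
  next
    fix v assume "v \<notin> V1 ?P'"
    then show "gw g v = undefined" using gn by (simp add: gw_def strats1_def PiE_iff extensional_def)
  qed
  have W_closed: "closed_under (step P fw (gw g)) W" if "g \<in> strats1 P" for g
    using closed_under_val_1[OF P' fw gw[OF that]] by (simp add: W)
  \<comment> \<open>Wherever \<open>g\<close> moves neutrally, play on \<open>W\<close> coincides
    with a play of the neutral subgame that \<open>fw\<close> controls.\<close>
  have step_W: "step P f' g v = step P fw (gw g) v"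
    if "v \<in> W" "v \<in> V1 P \<Longrightarrow> ?h (g v) = ?h v" for g v
    using that f'W by (auto simp: step_def gw_def)
  have win1: "win_prob P (step P fw (gw g)) v = 1" if "g \<in> strats1 P" "v \<in> W" for g v
    using val_le_val2[OF gw[OF that(1)], of fw v] win[OF that(2)] win_prob_le_1[of P "step P fw (gw g)" v]
    by (simp add: val2_eq_win_prob)
  have sub: "?h v \<le> expect (step P f' g) ?h v" if g: "g \<in> strats1 P" and v: "v \<in> verts P" for g v
  proof (cases "v \<in> V0 P")
    case True
    then show ?thesis using neutral by (simp add: step_def)
  next
    case False
    then have "step P f' g v = step P f g v" by (simp add: step_def)
    then show ?thesis using val_subharmonic[OF P f g v] by simp
  qed
  have le: "?h v \<le> val2 P f' g v" if g: "g \<in> strats1 P" and v: "v \<in> verts P" for g v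
    unfolding val2_eq_win_prob
  proof (rule subharmonic_le_win_prob[OF finite_verts[OF P] closed_under_step[OF P f'0 g] sub[OF g] _ v])
    let ?K = "step P f' g"
    fix C assume C: "C \<subseteq> verts P" "recurrent_class ?K C"
    then have fC: "finite C" and cl: "closed_under ?K C" and "C \<noteq> {}"
      using finite_verts[OF P] by (auto simp: recurrent_class_def intro: finite_subset)
    then obtain x where x: "x \<in> C" by auto
    \<comment> \<open>The subharmonic \<open>?h\<close> is constant on the recurrent class, and the
      move to \<open>g y\<close> stays in the class, so it is neutral.\<close>
    have "?h (g y) = ?h y" if "y \<in> C" "y \<in> V1 P" for y
    proof (rule subharmonic_recurrent_class[where d = ?h, OF fC C(2)])
      show "g y \<in> C" using closed_underD[OF cl that(1)] step_V1[OF P that(2)] by simp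
      show "?h z \<le> expect ?K ?h z" if "z \<in> C" for z using sub[OF g] C(1) that by blast
    qed fact
    then have K: "?K y = step P fw (gw g) y" if "y \<in> C" "y \<in> W" for y
      using that by (intro step_W) auto
    have "y \<in> C \<inter> W" if v: "v \<in> C \<inter> W" and y: "y \<in> set_pmf (?K v)" for v y
      using closed_underD[OF cl _ y] closed_underD[OF W_closed[OF g], of v y] K[of v] v y by simp
    then have "closed_under ?K (C \<inter> W)" unfolding closed_under_def by blast
    show "\<exists>v\<in>C. ?h v \<le> win_prob P ?K v"
    proof (cases "C \<inter> W = {}")
      case True
      then have "win_prob P ?K x = val2 P f g x"
        unfolding val2_eq_win_prob
        by (intro win_prob_cong[OF fC cl x]) (use True in \<open>auto simp: step_def intro!: f'f\<close>)
      then show ?thesis using val_le_val2[OF g, of f x] by (intro bexI[OF _ x]) simp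
    next
      case False
      then have "C \<subseteq> W" using recurrent_class_subset[OF C(2) \<open>closed_under ?K (C \<inter> W)\<close>] by auto
      then have "win_prob P ?K x = win_prob P (step P fw (gw g)) x"
        by (intro win_prob_cong[OF fC cl x] K) auto
      then show ?thesis
        using win1[OF g, of x] x \<open>C \<subseteq> W\<close> val_le_1[OF P, of f x] by (intro bexI[OF _ x]) auto
    qed
  qed
  have mono: "?h v \<le> val P f' v" if "v \<in> verts P" for v
    using le[OF _ that] val_attained[OF P, of f' v] by metis
  \<comment> \<open>Strictness of the inclusion supplies a vertex of \<open>W\<close> whose value
    under \<open>f\<close> is not 1; the improvement is shown to be strict there.\<close>
  obtain v where v: "v \<in> W" "v \<in> verts P" "?h v \<noteq> 1"
    using less W unfolding winning_region_fix_strategy[OF P f] W_def[symmetric] by blast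
  have "val P f' v \<noteq> ?h v"
  proof
    assume eq: "val P f' v = ?h v"
    obtain g where g: "g \<in> strats1 P" "val P f' v = val2 P f' g v" using val_attained[OF P] .
    let ?K = "step P f' g" and ?u = "val2 P f' g"
    \<comment> \<open>The vertices of \<open>W\<close> where equality persists: this set will turn
      out to be closed, so that a play from \<open>v\<close> never leaves it.\<close>
    let ?R = "{x \<in> W. ?u x = ?h x}"
    note cl = closed_under_step[OF P f'0 g(1)]
    \<comment> \<open>\<open>?h \<le> ?u\<close> holds on \<open>verts P\<close>, yet the mean of
      \<open>?u\<close> at \<open>x\<close> equals \<open>?h x\<close>, which is at most the mean of
      \<open>?h\<close>; so equality passes to every successor.\<close>
    have suc: "?h y = ?u y" if x: "x \<in> ?R" and y: "y \<in> set_pmf (?K x)" for x y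
    proof (rule expectation_eq_imp_eq[where a = ?h and b = ?u, OF _ _ _ y])
      have xv: "x \<in> verts P" using x W by blast
      show "finite (set_pmf (?K x))" using closed_under_finite[OF finite_verts[OF P] cl xv] .
      show "?h z \<le> ?u z" if "z \<in> set_pmf (?K x)" for z
        by (rule le[OF g(1) closed_underD[OF cl xv that]])
      have "expect ?K ?u x = ?h x" using val2_harmonic[OF P f'0 g(1) xv] x by simp
      also have "\<dots> \<le> expect ?K ?h x" by (rule sub[OF g(1) xv])
      finally show "expect ?K ?u x \<le> expect ?K ?h x" .
    qed
    have K: "?K x = step P fw (gw g) x" if x: "x \<in> ?R" for x
    proof (rule step_W)
      assume x1: "x \<in> V1 P"
      have xv: "x \<in> verts P" using x W by blast
      have "?h (g x) = ?u (g x)" using suc[OF x] step_V1[OF P x1] by simp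
      also have "\<dots> = ?u x" using val2_harmonic[OF P f'0 g(1) xv] step_V1[OF P x1] by simp
      finally show "?h (g x) = ?h x" using x by simp
    qed (use x in blast)
    have "y \<in> ?R" if x: "x \<in> ?R" and y: "y \<in> set_pmf (?K x)" for x y
      using suc[OF x y] closed_underD[OF W_closed[OF g(1)], of x y] K[OF x] x y by simp
    then have R: "closed_under ?K ?R" unfolding closed_under_def by blast
    have fin: "finite ?R" unfolding W using finite_verts[OF P] by simp
    have vR: "v \<in> ?R" using v(1) g(2) eq by simp
    \<comment> \<open>From \<open>v\<close> the chain is that of \<open>fw\<close> against the
      neutral \<open>gw g\<close>, won with probability 1, although \<open>?u v = ?h v\<close> is
      not 1.\<close>
    have "?u v = win_prob P (step P fw (gw g)) v"
      unfolding val2_eq_win_prob using fin R vR K unfolding val2_eq_win_prob by (rule win_prob_cong)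
    then show False using win1[OF g(1) v(1)] g(2) eq v(3) by simp
  qed
  then show ?thesis using mono v(2) by (auto simp: val_greater_def)
qed

theorem lemma1:
  fixes P :: "'v game" and f :: "'v \<Rightarrow> 'v"
  assumes "parity_game P"
    and "f \<in> strats0 P"
    and "winning_region (fix_strategy P f) \<subset> winning_region (neutral_subgame P f)"
  shows "additional_improvements P f \<noteq> {} \<and>
    (\<forall>f'\<in>additional_improvements P f. val_greater P f' f)"
  using additional_improvements_nonempty[OF assms] additional_improvements_val_greater[OF assms] by blast

end
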